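(* Let $(\mathcal{R},\partial,\int)$ be an integro-differential ring with induced evaluation $\mathrm{E}$. Then for all $f,g\in\mathcal{R}$ the following identities hold: $$\textstyle(\int f)(\int g)=\int\bigl(f\int g\bigr)+\int\bigl((\int f)g\bigr)+\mathrm{E}\bigl((\int f)(\int g)\bigr)$$ and $$\textstyle(\int\partial f)(\int\partial g)=(\int\partial f)\,g+f\int\partial g-\int\partial(fg)-\mathrm{E}\bigl((\int\partial f)(\int\partial g)\bigr).$$
   Context: Rings are unital, nonzero, not necessarily commutative, of arbitrary characteristic. A derivation on a ring $\mathcal{R}$ is an additive map $\partial$ with $\partial(fg)=(\partial f)g+f\,\partial g$; $\mathcal{C}=\{f\in\mathcal{R}:\partial f=0\}$ is the ring of constants of the differential ring $(\mathcal{R},\partial)$. "$\mathcal{C}$-linear" means homomorphism of $\mathcal{C}$-bimodules. An integro-differential ring $(\mathcal{R},\partial,\int)$ is a differential ring together with a $\mathcal{C}$-linear map $\int\colon\mathcal{R}\to\mathcal{R}$ satisfying $\partial\int f=f$ for all $f\in\mathcal{R}$. Its induced evaluation is $\mathrm{E}f:=f-\int\partial f$ (it takes values in $\mathcal{C}$). *)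

theory Defs
  imports Complex_Main
begin

text \<open>
  Class \<^class>\<open>ring_1\<close> is exactly the class of unital, nonzero (\<open>0 \<noteq> 1\<close>), not
  necessarily commutative rings of arbitrary characteristic.
\<close>

locale differential_ring = additive der
  for der :: "'a::ring_1 \<Rightarrow> 'a" +
  assumes der_mult: "der (f * g) = der f * g + f * der g"

definition constants :: "('a::ring_1 \<Rightarrow> 'a) \<Rightarrow> 'a set" where
  "constants der = {f. der f = 0}"

text \<open>
  The ring is a \<open>C\<close>-bimodule by left and right multiplication; since it need not be
  commutative, both actions have to be respected.
\<close>

locale bimodule_hom_on = additive L
  for C :: "'a::ring_1 set" and L :: "'a \<Rightarrow> 'a" +
  assumes left_linear: "c \<in> C \<Longrightarrow> L (c * f) = c * L f"
    and right_linear: "c \<in> C \<Longrightarrow> L (f * c) = L f * c"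

locale integro_differential_ring =
  differential_ring der + integral: bimodule_hom_on "constants der" integ
  for der integ :: "'a::ring_1 \<Rightarrow> 'a" +
  assumes der_integ: "der (integ f) = f"

definition induced_evaluation :: "('a::ring_1 \<Rightarrow> 'a) \<Rightarrow> ('a \<Rightarrow> 'a) \<Rightarrow> 'a \<Rightarrow> 'a" where
  "induced_evaluation der integ f = f - integ (der f)"

end

theory Submission
  imports Defs
begin

text \<open>
  The first identity is the definition of \<open>E\<close> applied to the product \<open>(\<integral>f)(\<integral>g)\<close>, whose derivative
  is given by the Leibniz rule. For the second, \<open>E\<close> is \<open>C\<close>-linear, takes values in \<open>C\<close> and fixes
  \<open>C\<close>; hence expanding \<open>E((f - E f)(g - E g))\<close> leaves \<open>E(f g) - (E f)(E g)\<close>.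
\<close>

context integro_differential_ring
begin

abbreviation E :: "'a \<Rightarrow> 'a" where
  "E \<equiv> induced_evaluation der integ"

lemma integ_der: "integ (der f) = f - E f"
  by (simp add: induced_evaluation_def)

lemma evaluation_in_constants: "E f \<in> constants der"
  by (simp add: induced_evaluation_def constants_def diff der_integ)

lemma evaluation_diff: "E (f - g) = E f - E g"
  by (simp add: induced_evaluation_def diff integral.diff)

text \<open>Since \<open>der c = 0\<close> kills one Leibniz term, multiplication by
  \<open>c\<close> commutes with \<open>der\<close> as well as with \<open>integ\<close>.\<close>

lemma evaluation_mult_left:
  assumes "c \<in> constants der"
  shows "E (c * f) = c * E f"
proof -
  have "der (c * f) = c * der f"
    using assms by (simp add: constants_def der_mult)
  then show ?thesis
    using assms by (simp add: induced_evaluation_def integral.left_linear right_diff_distrib)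
qed

lemma evaluation_mult_right:
  assumes "c \<in> constants der"
  shows "E (f * c) = E f * c"
proof -
  have "der (f * c) = der f * c"
    using assms by (simp add: constants_def der_mult)
  then show ?thesis
    using assms by (simp add: induced_evaluation_def integral.right_linear left_diff_distrib)
qed

lemma evaluation_constant: "c \<in> constants der \<Longrightarrow> E c = c"
  by (simp add: induced_evaluation_def constants_def integral.zero)

lemma integ_mult_integ:
  "integ f * integ g = integ (f * integ g) + integ (integ f * g) + E (integ f * integ g)"
  by (simp add: induced_evaluation_def der_mult der_integ integral.add)

text \<open>\<open>E f * g\<close>, \<open>f * E g\<close> and \<open>E f * E g\<close> all evaluate
  to \<open>E f * E g\<close>; the first needs left linearity, the second right linearity.\<close>

lemma evaluation_integ_der_mult:
  "E (integ (der f) * integ (der g)) = E (f * g) - E f * E g"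
  by (simp add: integ_der left_diff_distrib right_diff_distrib evaluation_diff
      evaluation_mult_left evaluation_mult_right evaluation_constant evaluation_in_constants)

lemma integ_der_mult_integ_der:
  "integ (der f) * integ (der g) =
    integ (der f) * g + f * integ (der g) - integ (der (f * g)) - E (integ (der f) * integ (der g))"
  \<comment> \<open>The two terms \<open>E (f * g)\<close> cancel; both sides become
    \<open>f * g - E f * g - f * E g + E f * E g\<close>.\<close>
  unfolding evaluation_integ_der_mult by (simp add: integ_der algebra_simps)

end

theorem theorem3p1:
  fixes der integ :: "'a::ring_1 \<Rightarrow> 'a"
  assumes "integro_differential_ring der integ"
  shows "\<forall>f g. integ f * integ g =
             integ (f * integ g) + integ (integ f * g)
               + induced_evaluation der integ (integ f * integ g)
         \<and> integ (der f) * integ (der g) =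
             integ (der f) * g + f * integ (der g) - integ (der (f * g))
               - induced_evaluation der integ (integ (der f) * integ (der g))"
  using integro_differential_ring.integ_mult_integ[OF assms]
    integro_differential_ring.integ_der_mult_integ_der[OF assms]
  by blast

end
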